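(* Let $A,C\in\mathbb{R}^{m\times m}$ and $B,D\in\mathbb{R}^{p\times p}$, where $A$ and $B$ are nonsingular. If $$\rho(|B^{-1}D|)\,\rho(|CA^{-1}|)<1,$$ then for every $F\in\mathbb{R}^{m\times p}$ the equation $$AXB-|CXD|=F$$ has a unique solution $X\in\mathbb{R}^{m\times p}$.
   Context: $|M|$ denotes the entrywise absolute value of a real matrix $M$; $\rho(\cdot)$ denotes the spectral radius. The equation $AXB-|CXD|=F$ is called the new Sylvester-like absolute value equation; in general $A,C\in\mathbb{R}^{m\times n}$, $B,D\in\mathbb{R}^{p\times q}$, $F\in\mathbb{R}^{m\times q}$, and $X\in\mathbb{R}^{n\times p}$ is the unknown. Here $A$ and $B$ are square, so $m=n$ and $p=q$. *)

theory Defs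
  imports
    "Jordan_Normal_Form.Spectral_Radius"
    "Jordan_Normal_Form.Gauss_Jordan_Elimination"
begin

definition abs_mat :: "real mat \<Rightarrow> real mat" where
  "abs_mat M = map_mat abs M"

text \<open>Eigenvalues of a real matrix are taken over the complex numbers.\<close>

definition real_spectral_radius :: "real mat \<Rightarrow> real" where
  "real_spectral_radius M = spectral_radius (map_mat complex_of_real M)"

text \<open>Only meaningful for invertible matrices; otherwise \<^term>\<open>mat_inverse M\<close> is \<^const>\<open>None\<close>.\<close>

definition mat_inv :: "real mat \<Rightarrow> real mat" where
  "mat_inv M = the (mat_inverse M)"

lemma mat_inv:
  assumes M: "M \<in> carrier_mat n n" and inv: "invertible_mat M"
  shows "mat_inv M \<in> carrier_mat n n" "M * mat_inv M = 1\<^sub>m n" "mat_inv M * M = 1\<^sub>m n"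
proof -
  from inv obtain N where N: "M * N = 1\<^sub>m (dim_row M)" "N * M = 1\<^sub>m (dim_row N)"
    unfolding invertible_mat_def inverts_mat_def by auto
  have "dim_row N = n" "dim_col N = n"
    using arg_cong[OF N(1), of dim_col] arg_cong[OF N(2), of dim_col] M by auto
  then have "M \<in> Units (ring_mat TYPE(real) n ())"
    using M N by (auto simp: Units_def ring_mat_def intro!: bexI[of _ N])
  then obtain K where "mat_inverse M = Some K"
    using mat_inverse(1)[OF M, of "()"] by (cases "mat_inverse M") auto
  with mat_inverse(2)[OF M this]
  show "mat_inv M \<in> carrier_mat n n" "M * mat_inv M = 1\<^sub>m n" "mat_inv M * M = 1\<^sub>m n"
    by (auto simp: mat_inv_def)
qed

end

theory Submission
  imports Defs
begin

text \<open>
  Substituting \<open>Y = A X B\<close> turns the equation into the fixed point equation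
  \<open>Y = |P Y Q| + F\<close> with \<open>P = C A\<inverse>\<close> and \<open>Q = B\<inverse> D\<close>. Differences of its Picard iterates
  satisfy \<open>W\<^sub>k\<^sub>+\<^sub>1 \<le> |P| W\<^sub>k |Q|\<close> entrywise, hence \<open>W\<^sub>k \<le> |P|\<^sup>k W\<^sub>0 |Q|\<^sup>k\<close>. If \<open>a > \<rho>(|P|)\<close>,
  the powers of \<open>|P|/a\<close> are bounded (Jordan normal form), and similarly for \<open>b > \<rho>(|Q|)\<close>.
  Choosing \<open>a b < 1\<close> gives geometric decay, thus convergence of the iteration and uniqueness.
\<close>

section \<open>Powers of a matrix and its spectral radius\<close>

lemma smult_pow_mat:
  fixes M :: "'a :: comm_semiring_1 mat"
  assumes M: "M \<in> carrier_mat n n"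
  shows "(c \<cdot>\<^sub>m M) ^\<^sub>m k = c ^ k \<cdot>\<^sub>m (M ^\<^sub>m k)"
proof (induction k)
  case 0
  show ?case using M by (auto intro!: eq_matI)
next
  case (Suc k)
  have comm: "c \<cdot>\<^sub>m (c ^ k \<cdot>\<^sub>m X) = c ^ k \<cdot>\<^sub>m (c \<cdot>\<^sub>m X)" for X :: "'a mat"
    by (intro eq_matI) (auto simp: ac_simps)
  have "(c \<cdot>\<^sub>m M) ^\<^sub>m Suc k = (c ^ k \<cdot>\<^sub>m (M ^\<^sub>m k)) * (c \<cdot>\<^sub>m M)"
    by (simp add: Suc)
  also have "\<dots> = c ^ k \<cdot>\<^sub>m (c \<cdot>\<^sub>m ((M ^\<^sub>m k) * M))"
    using M by (simp add: mult_smult_assoc_mat[of _ n n _ n] mult_smult_distrib[of _ n n _ n] comm)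
  also have "\<dots> = c ^ Suc k \<cdot>\<^sub>m (M ^\<^sub>m Suc k)"
    by (auto intro!: eq_matI simp: ac_simps)
  finally show ?case .
qed

text \<open>The recursion of \<open>^\<^sub>m\<close> multiplies on the right; a sandwich around
  \<open>W\<close> also needs a new factor on the outer left.\<close>

lemma pow_mat_Suc_left:
  fixes M :: "'a :: semiring_1 mat"
  assumes M: "M \<in> carrier_mat n n"
  shows "M ^\<^sub>m Suc k = M * M ^\<^sub>m k"
proof (induction k)
  case 0
  show ?case using M by simp
next
  case (Suc k)
  have "M ^\<^sub>m Suc (Suc k) = (M * M ^\<^sub>m k) * M" using Suc by simp
  then show ?case using M by (simp add: assoc_mult_mat[of _ n n _ n _ n])
qed

text \<open>In positive dimension the spectrum is nonempty, so the radius is the norm of an actual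
  eigenvalue.\<close>

lemma real_spectral_radius_nonneg:
  assumes "M \<in> carrier_mat n n" "n > 0"
  shows "real_spectral_radius M \<ge> 0"
proof -
  have "map_mat complex_of_real M \<in> carrier_mat n n" using assms by simp
  from spectral_radius_mem_max(1)[OF this \<open>n > 0\<close>]
  show ?thesis by (auto simp: real_spectral_radius_def)
qed

text \<open>Dividing by \<open>a\<close> pushes the spectral radius strictly below 1, where powers
  stay bounded; multiplying back gives the factor \<open>a ^ k\<close>. The strict gap absorbs the
  polynomial growth that Jordan blocks may cause.\<close>

lemma pow_mat_entry_bound:
  fixes M :: "real mat"
  assumes M: "M \<in> carrier_mat n n" and n: "n > 0"
    and a: "real_spectral_radius M < a"
  shows "\<exists>c. \<forall>k. norm_bound (M ^\<^sub>m k) (c * a ^ k)"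
proof -
  have a0: "a > 0" using real_spectral_radius_nonneg[OF M n] a by simp
  let ?M = "map_mat complex_of_real M"
  let ?N = "complex_of_real (1 / a) \<cdot>\<^sub>m ?M"
  have cM: "?M \<in> carrier_mat n n" and cN: "?N \<in> carrier_mat n n" using M by auto
  obtain ev where ev: "ev \<in> spectrum ?N" "spectral_radius ?N = norm ev"
    using spectral_radius_mem_max(1)[OF cN n] by auto
  then obtain v where v: "v \<in> carrier_vec n" "v \<noteq> 0\<^sub>v n" "?N *\<^sub>v v = ev \<cdot>\<^sub>v v"
    using cN by (auto simp: spectrum_def eigenvalue_def eigenvector_def)
  \<comment> \<open>An eigenvector of the scaled matrix is one of \<open>M\<close> itself, with the
    eigenvalue multiplied by \<open>a\<close>.\<close>
  have "?M *\<^sub>v v = complex_of_real a \<cdot>\<^sub>v (?N *\<^sub>v v)"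
    using M a0 v(1) by (intro eq_vecI) (auto simp: scalar_prod_def sum_distrib_left)
  then have "?M *\<^sub>v v = (complex_of_real a * ev) \<cdot>\<^sub>v v"
    using v(3) by (simp add: smult_smult_assoc)
  then have "complex_of_real a * ev \<in> spectrum ?M"
    using v cM unfolding spectrum_def eigenvalue_def eigenvector_def by auto
  then have "norm (complex_of_real a * ev) \<le> spectral_radius ?M"
    by (intro spectral_radius_mem_max(2)[OF cM n]) auto
  then have "a * norm ev \<le> real_spectral_radius M"
    using a0 by (simp add: norm_mult real_spectral_radius_def)
  also have "\<dots> < a" by (rule a)
  finally have "spectral_radius ?N < 1" using a0 ev(2) by simp
  from spectral_radius_jnf_norm_bound_less_1_upper_triangular[OF cN this]
  obtain c where c: "\<And>k. norm_bound (?N ^\<^sub>m k) c" by auto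
  have "norm_bound (M ^\<^sub>m k) (c * a ^ k)" for k
  proof
    fix i j assume "i < dim_row (M ^\<^sub>m k)" "j < dim_col (M ^\<^sub>m k)"
    then have ij: "i < n" "j < n" using M by (auto split: if_splits)
    \<comment> \<open>Powers commute with scaling and with the embedding into the complex numbers,
      so the bound on \<open>?N\<close> transfers to the real matrix \<open>M\<close>.\<close>
    have eq: "?N ^\<^sub>m k = complex_of_real (1 / a) ^ k \<cdot>\<^sub>m map_mat complex_of_real (M ^\<^sub>m k)"
      using smult_pow_mat[OF cM] by (simp add: of_real_hom.mat_hom_pow[OF M])
    have "norm ((?N ^\<^sub>m k) $$ (i, j)) \<le> c"
      using c[of k] ij by (simp only: norm_bound_def carrier_matD[OF pow_carrier_mat[OF cN]])
    then have "(1 / a) ^ k * \<bar>(M ^\<^sub>m k) $$ (i, j)\<bar> \<le> c"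
      unfolding eq using ij M a0 by (simp add: norm_mult norm_power norm_divide)
    then show "norm ((M ^\<^sub>m k) $$ (i, j)) \<le> c * a ^ k"
      using a0 by (simp add: field_simps)
  qed
  then show ?thesis by blast
qed

section \<open>Geometric decay of two-sided products\<close>

lemma ex_larger_factors_product_less_1:
  fixes s t :: real
  assumes "s \<ge> 0" "t \<ge> 0" "s * t < 1"
  shows "\<exists>a b. s < a \<and> t < b \<and> a * b < 1"
proof -
  obtain a where a: "s < a" "a * t < 1"
  \<comment> \<open>For positive \<open>t\<close>, \<open>a\<close> is taken between
    \<open>s\<close> and \<open>1 / t\<close>. For \<open>t = 0\<close> the quotient is 0 by
    convention and leaves no such room, but any \<open>a > s\<close> works.\<close>
  proof (cases "t = 0")
    case True
    then show ?thesis using that[of "s + 1"] by simp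
  next
    case False
    then have "t > 0" "s < 1 / t" using assms by (auto simp: field_simps)
    then obtain a where "s < a" "a < 1 / t" using dense by blast
    then show ?thesis using that \<open>t > 0\<close> by (auto simp: field_simps)
  qed
  then have "a > 0" "t < 1 / a" using assms by (auto simp: field_simps)
  then obtain b where "t < b" "b < 1 / a" using dense by blast
  then show ?thesis using a \<open>a > 0\<close> by (auto simp: field_simps)
qed

text \<open>The entries of the two powers grow at most like \<open>a ^ k\<close> and
  \<open>b ^ k\<close>, and \<open>a * b < 1\<close> is possible. The rate \<open>r\<close> is fixed
  before \<open>W\<close>; only the constant \<open>K\<close> depends on \<open>W\<close>.\<close>

lemma sandwich_pow_geometric_decay:
  fixes P Q :: "real mat"
  assumes P: "P \<in> carrier_mat m m" and Q: "Q \<in> carrier_mat p p"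
    and "m > 0" "p > 0"
    and lt: "real_spectral_radius P * real_spectral_radius Q < 1"
  obtains r where "0 \<le> r" "r < 1"
    "\<And>W. W \<in> carrier_mat m p \<Longrightarrow> \<exists>K. \<forall>k. norm_bound (P ^\<^sub>m k * W * Q ^\<^sub>m k) (K * r ^ k)"
proof -
  note s = real_spectral_radius_nonneg[OF P \<open>m > 0\<close>]
  note t = real_spectral_radius_nonneg[OF Q \<open>p > 0\<close>]
  obtain a b where ab: "real_spectral_radius P < a" "real_spectral_radius Q < b" "a * b < 1"
    using ex_larger_factors_product_less_1[OF s t lt] by blast
  obtain c where c: "\<And>k. norm_bound (P ^\<^sub>m k) (c * a ^ k)"
    using pow_mat_entry_bound[OF P \<open>m > 0\<close> ab(1)] by blast
  obtain d where d: "\<And>k. norm_bound (Q ^\<^sub>m k) (d * b ^ k)"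
    using pow_mat_entry_bound[OF Q \<open>p > 0\<close> ab(2)] by blast
  show ?thesis
  proof (rule that[of "a * b"])
    show "0 \<le> a * b" using s t ab by simp
    show "a * b < 1" by (rule ab)
    fix W :: "real mat" assume W: "W \<in> carrier_mat m p"
    obtain w where w: "norm_bound W w"
      by (rule that[of "Max ((\<lambda>(i, j). norm (W $$ (i, j))) ` ({..<dim_row W} \<times> {..<dim_col W}))"])
        (auto intro!: Max_ge)
    have "norm_bound (P ^\<^sub>m k * W * Q ^\<^sub>m k) ((c * w * real m * d * real p) * (a * b) ^ k)" for k
    proof -
      \<comment> \<open>Each entry of a product is a sum over the inner dimension, whence the
        factors \<open>real m\<close> and \<open>real p\<close>.\<close>
      have "norm_bound (P ^\<^sub>m k * W * Q ^\<^sub>m k) (((c * a ^ k) * w * real m) * (d * b ^ k) * real p)"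
        using P Q W by (intro norm_bound_mult[of _ m p _ p] norm_bound_mult[of _ m m _ p] c d w) auto
      then show ?thesis by (simp add: power_mult_distrib ac_simps)
    qed
    then show "\<exists>K. \<forall>k. norm_bound (P ^\<^sub>m k * W * Q ^\<^sub>m k) (K * (a * b) ^ k)" by blast
  qed
qed

section \<open>Entrywise order and matrix products\<close>

lemma mult_mat_index_sum:
  assumes "A \<in> carrier_mat nr n" "B \<in> carrier_mat n nc" "i < nr" "j < nc"
  shows "(A * B) $$ (i, j) = (\<Sum>t<n. A $$ (i, t) * B $$ (t, j))"
  using assms by (simp add: scalar_prod_def atLeast0LessThan)

lemma less_eq_mat_iff:
  assumes "A \<in> carrier_mat nr nc" "B \<in> carrier_mat nr nc"
  shows "A \<le> B \<longleftrightarrow> (\<forall>i<nr. \<forall>j<nc. A $$ (i, j) \<le> B $$ (i, j))"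
  using assms by (auto simp: less_eq_mat_def)

lemma mult_mat_left_mono:
  fixes A :: "real mat"
  assumes "A \<in> carrier_mat nr n" "B \<in> carrier_mat n nc" "B' \<in> carrier_mat n nc"
    and "0\<^sub>m nr n \<le> A" "B \<le> B'"
  shows "A * B \<le> A * B'"
  using assms unfolding less_eq_mat_iff[OF mult_carrier_mat[OF assms(1,2)] mult_carrier_mat[OF assms(1,3)]]
  by (auto simp: mult_mat_index_sum less_eq_mat_iff[of _ nr n] less_eq_mat_iff[of _ n nc]
      simp del: index_mult_mat(1) intro!: sum_mono mult_left_mono)

lemma mult_mat_right_mono:
  fixes A :: "real mat"
  assumes "A \<in> carrier_mat nr n" "A' \<in> carrier_mat nr n" "B \<in> carrier_mat n nc"
    and "0\<^sub>m n nc \<le> B" "A \<le> A'"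
  shows "A * B \<le> A' * B"
  using assms unfolding less_eq_mat_iff[OF mult_carrier_mat[OF assms(1,3)] mult_carrier_mat[OF assms(2,3)]]
  by (auto simp: mult_mat_index_sum less_eq_mat_iff[of _ nr n] less_eq_mat_iff[of _ n nc]
      simp del: index_mult_mat(1) intro!: sum_mono mult_right_mono)

text \<open>Pure associativity. It merges a further pair of outer factors with the powers, and later
  cancels \<open>A\<close> and \<open>B\<close> against their inverses.\<close>

lemma sandwich_sandwich_mat:
  fixes P R W S Q :: "'a :: semiring_0 mat"
  assumes P: "P \<in> carrier_mat n1 n2" and R: "R \<in> carrier_mat n2 n3" and W: "W \<in> carrier_mat n3 n4"
    and S: "S \<in> carrier_mat n4 n5" and Q: "Q \<in> carrier_mat n5 n6"
  shows "P * (R * W * S) * Q = (P * R) * W * (S * Q)"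
proof -
  have "P * (R * W * S) = P * R * W * S"
    using assoc_mult_mat[OF P mult_carrier_mat[OF R W] S] assoc_mult_mat[OF P R W] by simp
  then show ?thesis
    using assoc_mult_mat[OF mult_carrier_mat[OF mult_carrier_mat[OF P R] W] S Q] by simp
qed

text \<open>Nonnegativity of \<open>P\<close> and \<open>Q\<close> makes the map from
  \<open>W\<close> to \<open>P * W * Q\<close> monotone, so the one-step estimate can be
  iterated.\<close>

lemma sandwich_iterate_le:
  fixes P Q :: "real mat"
  assumes P: "P \<in> carrier_mat m m" "0\<^sub>m m m \<le> P" and Q: "Q \<in> carrier_mat p p" "0\<^sub>m p p \<le> Q"
    and W: "\<And>k. W k \<in> carrier_mat m p"
    and step: "\<And>k. W (Suc k) \<le> P * W k * Q"
  shows "W k \<le> P ^\<^sub>m k * W 0 * Q ^\<^sub>m k"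
proof (induction k)
  case 0
  show ?case using P Q W[of 0] by simp
next
  case (Suc k)
  let ?V = "P ^\<^sub>m k * W 0 * Q ^\<^sub>m k"
  note carr = W[of 0] pow_carrier_mat[OF P(1), of k] pow_carrier_mat[OF Q(1), of k]
  have V: "?V \<in> carrier_mat m p" using carr by simp
  have "W (Suc k) \<le> P * W k * Q" by (rule step)
  also have "\<dots> \<le> P * ?V * Q"
    using P Q W V Suc by (intro mult_mat_right_mono[of _ m p _ _ p] mult_mat_left_mono[of _ m m _ p]) auto
  also have "P * ?V * Q = (P * P ^\<^sub>m k) * W 0 * (Q ^\<^sub>m k * Q)"
    by (rule sandwich_sandwich_mat[OF P(1) carr(2,1,3) Q(1)])
  also have "\<dots> = P ^\<^sub>m Suc k * W 0 * Q ^\<^sub>m Suc k"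
    using pow_mat_Suc_left[OF P(1), of k] by simp
  finally show ?case .
qed

section \<open>Entrywise absolute value\<close>

lemma abs_mat_carrier [simp]: "abs_mat M \<in> carrier_mat nr nc \<longleftrightarrow> M \<in> carrier_mat nr nc"
  by (simp add: abs_mat_def)

lemma index_abs_mat [simp]:
  "i < dim_row M \<Longrightarrow> j < dim_col M \<Longrightarrow> abs_mat M $$ (i, j) = \<bar>M $$ (i, j)\<bar>"
  "dim_row (abs_mat M) = dim_row M" "dim_col (abs_mat M) = dim_col M"
  by (simp_all add: abs_mat_def)

lemma abs_mat_nonneg: "M \<in> carrier_mat nr nc \<Longrightarrow> 0\<^sub>m nr nc \<le> abs_mat M"
  by (auto simp: less_eq_mat_def)

text \<open>Triangle inequality in the sum that defines each entry.\<close>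

lemma abs_mat_mult_le:
  assumes A: "A \<in> carrier_mat nr n" and B: "B \<in> carrier_mat n nc"
  shows "abs_mat (A * B) \<le> abs_mat A * abs_mat B"
proof -
  have "\<bar>\<Sum>t<n. A $$ (i, t) * B $$ (t, j)\<bar> \<le> (\<Sum>t<n. \<bar>A $$ (i, t)\<bar> * \<bar>B $$ (t, j)\<bar>)" for i j
    using sum_abs[of "\<lambda>t. A $$ (i, t) * B $$ (t, j)" "{..<n}"] by (simp add: abs_mult)
  then show ?thesis
    using A B
    by (auto simp: less_eq_mat_def scalar_prod_def atLeast0LessThan)
qed

text \<open>\<open>F\<close> cancels, and the reverse triangle inequality applies in each
  entry.\<close>

lemma abs_mat_diff_abs_mat_le:
  assumes "U \<in> carrier_mat nr nc" "V \<in> carrier_mat nr nc" "F \<in> carrier_mat nr nc"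
  shows "abs_mat ((abs_mat U + F) - (abs_mat V + F)) \<le> abs_mat (U - V)"
  using assms by (auto simp: less_eq_mat_def)

text \<open>The one-step estimate for the iteration: the absolute value is nonexpansive, the product
  is linear in its middle factor, and absolute values are then moved inside the two
  products.\<close>

lemma abs_mat_sandwich_le:
  assumes P: "P \<in> carrier_mat m m" and Q: "Q \<in> carrier_mat p p"
    and Y: "Y \<in> carrier_mat m p" and Z: "Z \<in> carrier_mat m p" and F: "F \<in> carrier_mat m p"
  shows "abs_mat ((abs_mat (P * Y * Q) + F) - (abs_mat (P * Z * Q) + F))
    \<le> abs_mat P * abs_mat (Y - Z) * abs_mat Q"
proof -
  have PY: "P * Y \<in> carrier_mat m p" and PZ: "P * Z \<in> carrier_mat m p" using P Y Z by auto
  have PYQ: "P * Y * Q \<in> carrier_mat m p" and PZQ: "P * Z * Q \<in> carrier_mat m p"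
    using PY PZ Q by auto
  have D: "Y - Z \<in> carrier_mat m p" using Y Z by auto
  have PD: "P * (Y - Z) \<in> carrier_mat m p" using P D by auto
  have "abs_mat ((abs_mat (P * Y * Q) + F) - (abs_mat (P * Z * Q) + F))
      \<le> abs_mat (P * Y * Q - P * Z * Q)"
    by (rule abs_mat_diff_abs_mat_le[OF PYQ PZQ F])
  also have "P * Y * Q - P * Z * Q = P * (Y - Z) * Q"
    using minus_mult_distrib_mat[OF PY PZ Q] mult_minus_distrib_mat[OF P Y Z] by simp
  also have "abs_mat (P * (Y - Z) * Q) \<le> abs_mat (P * (Y - Z)) * abs_mat Q"
    by (rule abs_mat_mult_le[OF PD Q])
  also have "\<dots> \<le> abs_mat P * abs_mat (Y - Z) * abs_mat Q"
  proof (rule mult_mat_right_mono)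
    show "abs_mat (P * (Y - Z)) \<le> abs_mat P * abs_mat (Y - Z)" by (rule abs_mat_mult_le[OF P D])
    show "abs_mat P * abs_mat (Y - Z) \<in> carrier_mat m p" using P D by (auto intro!: mult_carrier_mat)
  qed (use PD Q in \<open>auto intro: abs_mat_nonneg\<close>)
  finally show ?thesis .
qed

section \<open>Convergence of the iteration and its fixed point\<close>

text \<open>Each entry of the product is a finite linear combination of the entries of the middle
  factor, so entrywise limits pass through.\<close>

lemma tendsto_sandwich_entry:
  fixes P Q :: "real mat"
  assumes P: "P \<in> carrier_mat m m" and Q: "Q \<in> carrier_mat p p"
    and Y: "\<And>k. Y k \<in> carrier_mat m p" and L: "L \<in> carrier_mat m p"
    and lim: "\<And>i j. i < m \<Longrightarrow> j < p \<Longrightarrow> (\<lambda>k. Y k $$ (i, j)) \<longlonglongrightarrow> L $$ (i, j)"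
    and ij: "i < m" "j < p"
  shows "(\<lambda>k. (P * Y k * Q) $$ (i, j)) \<longlonglongrightarrow> (P * L * Q) $$ (i, j)"
proof -
  have entry: "(P * Z * Q) $$ (i, j) = (\<Sum>t<p. (\<Sum>s<m. P $$ (i, s) * Z $$ (s, t)) * Q $$ (t, j))"
    if Z: "Z \<in> carrier_mat m p" for Z
  proof -
    have "(P * Z * Q) $$ (i, j) = (\<Sum>t<p. (P * Z) $$ (i, t) * Q $$ (t, j))"
      by (rule mult_mat_index_sum[OF mult_carrier_mat[OF P Z] Q ij])
    also have "\<dots> = (\<Sum>t<p. (\<Sum>s<m. P $$ (i, s) * Z $$ (s, t)) * Q $$ (t, j))"
    proof (rule sum.cong)
      fix t assume "t \<in> {..<p}"
      then have "(P * Z) $$ (i, t) = (\<Sum>s<m. P $$ (i, s) * Z $$ (s, t))"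
        by (intro mult_mat_index_sum[OF P Z ij(1)]) simp
      then show "(P * Z) $$ (i, t) * Q $$ (t, j) = (\<Sum>s<m. P $$ (i, s) * Z $$ (s, t)) * Q $$ (t, j)"
        by (rule arg_cong)
    qed (rule refl)
    finally show ?thesis .
  qed
  have "(\<lambda>k. \<Sum>t<p. (\<Sum>s<m. P $$ (i, s) * Y k $$ (s, t)) * Q $$ (t, j))
      \<longlonglongrightarrow> (\<Sum>t<p. (\<Sum>s<m. P $$ (i, s) * L $$ (s, t)) * Q $$ (t, j))"
    by (rule tendsto_sum, rule tendsto_mult_right, rule tendsto_sum, rule tendsto_mult_left)
      (simp add: lim)
  then show ?thesis
    by (simp only: entry[OF Y] entry[OF L])
qed

text \<open>The increments are summable by comparison with a geometric series, and their partial
  sums telescope.\<close>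

lemma convergent_of_geometric_increments:
  fixes f :: "nat \<Rightarrow> real"
  assumes "0 \<le> r" "r < 1" "\<And>k. \<bar>f (Suc k) - f k\<bar> \<le> K * r ^ k"
  shows "convergent f"
proof -
  have "summable (\<lambda>k. K * r ^ k)"
    using assms by (intro summable_mult summable_geometric) auto
  then have "summable (\<lambda>k. f (Suc k) - f k)"
    by (rule summable_comparison_test'[where N = 0]) (simp add: assms(3))
  then have "convergent (\<lambda>n. \<Sum>k<n. f (Suc k) - f k)"
    by (simp only: summable_iff_convergent)
  then have "convergent (\<lambda>n. f n - f 0)"
    by (simp only: sum_lessThan_telescope)
  then have "convergent (\<lambda>n. (f n - f 0) + f 0)"
    by (intro convergent_add convergent_const)
  then show ?thesis by simp
qed

lemma abs_sandwich_fixed_point_unique: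
  fixes P Q F :: "real mat"
  assumes P: "P \<in> carrier_mat m m" and Q: "Q \<in> carrier_mat p p" and F: "F \<in> carrier_mat m p"
    and "m > 0" "p > 0"
    and lt: "real_spectral_radius (abs_mat P) * real_spectral_radius (abs_mat Q) < 1"
  shows "\<exists>!Y. Y \<in> carrier_mat m p \<and> Y = abs_mat (P * Y * Q) + F"
proof -
  define T where "T = (\<lambda>Y. abs_mat (P * Y * Q) + F)"
  have T: "T Y \<in> carrier_mat m p" if "Y \<in> carrier_mat m p" for Y using F by (simp add: T_def)
  have aP: "abs_mat P \<in> carrier_mat m m" and aQ: "abs_mat Q \<in> carrier_mat p p" using P Q by auto
  obtain r where r: "0 \<le> r" "r < 1"
    and decay: "\<And>W. W \<in> carrier_mat m p \<Longrightarrow>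
      \<exists>K. \<forall>k. norm_bound (abs_mat P ^\<^sub>m k * W * abs_mat Q ^\<^sub>m k) (K * r ^ k)"
    using sandwich_pow_geometric_decay[OF aP aQ \<open>m > 0\<close> \<open>p > 0\<close> lt] by blast
  \<comment> \<open>Any two orbits of \<open>T\<close> approach each other geometrically. An orbit
    and its shift give existence; two constant orbits give uniqueness.\<close>
  have iterates: "\<exists>K. \<forall>k i j. i < m \<longrightarrow> j < p \<longrightarrow> \<bar>Y k $$ (i, j) - Z k $$ (i, j)\<bar> \<le> K * r ^ k"
    if Y: "\<And>k. Y k \<in> carrier_mat m p" "\<And>k. Y (Suc k) = T (Y k)"
      and Z: "\<And>k. Z k \<in> carrier_mat m p" "\<And>k. Z (Suc k) = T (Z k)" for Y Z
  proof -
    define W where "W = (\<lambda>k. abs_mat (Y k - Z k))"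
    have W: "W k \<in> carrier_mat m p" for k using minus_carrier_mat[OF Z(1)] by (simp add: W_def)
    have "W (Suc k) \<le> abs_mat P * W k * abs_mat Q" for k
      unfolding W_def Y(2) Z(2) T_def by (rule abs_mat_sandwich_le[OF P Q Y(1) Z(1) F])
    then have le: "W k \<le> abs_mat P ^\<^sub>m k * W 0 * abs_mat Q ^\<^sub>m k" for k
      using P Q by (intro sandwich_iterate_le[OF aP _ aQ _ W]) (auto intro: abs_mat_nonneg)
    obtain K where K: "\<And>k. norm_bound (abs_mat P ^\<^sub>m k * W 0 * abs_mat Q ^\<^sub>m k) (K * r ^ k)"
      using decay[OF W] by blast
    have "\<bar>Y k $$ (i, j) - Z k $$ (i, j)\<bar> \<le> K * r ^ k" if ij: "i < m" "j < p" for k i j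
    proof -
      let ?V = "abs_mat P ^\<^sub>m k * W 0 * abs_mat Q ^\<^sub>m k"
      have V: "?V \<in> carrier_mat m p"
        using W[of 0] pow_carrier_mat[OF aP, of k] pow_carrier_mat[OF aQ, of k] by simp
      have "\<bar>Y k $$ (i, j) - Z k $$ (i, j)\<bar> = W k $$ (i, j)"
        using Y(1)[of k] Z(1)[of k] ij by (simp add: W_def)
      also have "\<dots> \<le> ?V $$ (i, j)"
        using le[of k] ij by (simp only: less_eq_mat_iff[OF W V])
      also have "\<dots> \<le> norm (?V $$ (i, j))" by simp
      also have "\<dots> \<le> K * r ^ k"
        using K[of k] ij by (simp only: norm_bound_def carrier_matD[OF V])
      finally show ?thesis .
    qed
    then show ?thesis by blast
  qed
  have geometric_null: "(\<lambda>k. K * r ^ k) \<longlonglongrightarrow> 0" for K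
    using tendsto_mult_right_zero[OF LIMSEQ_power_zero[of r]] r by simp
  define Y where "Y = (\<lambda>k. (T ^^ k) (0\<^sub>m m p))"
  have Y: "Y k \<in> carrier_mat m p" for k by (induction k) (auto simp: Y_def T)
  have Y_Suc: "Y (Suc k) = T (Y k)" for k by (simp add: Y_def)
  \<comment> \<open>The orbit of the zero matrix is compared with its own shift, which bounds its
    increments.\<close>
  obtain K where K: "\<forall>k i j. i < m \<longrightarrow> j < p \<longrightarrow> \<bar>Y (Suc k) $$ (i, j) - Y k $$ (i, j)\<bar> \<le> K * r ^ k"
    using iterates[of "\<lambda>k. Y (Suc k)" Y, OF Y Y_Suc Y Y_Suc] ..
  then have conv: "convergent (\<lambda>k. Y k $$ (i, j))" if "i < m" "j < p" for i j
    using K that by (intro convergent_of_geometric_increments[OF r, of _ K]) simp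
  \<comment> \<open>\<open>lim\<close> is meaningful here because every entry sequence converges by
    \<open>conv\<close>.\<close>
  define L where "L = mat m p (\<lambda>(i, j). lim (\<lambda>k. Y k $$ (i, j)))"
  have L: "L \<in> carrier_mat m p" by (simp add: L_def)
  have lim: "(\<lambda>k. Y k $$ (i, j)) \<longlonglongrightarrow> L $$ (i, j)" if "i < m" "j < p" for i j
    using conv[OF that] that by (simp add: L_def convergent_LIMSEQ_iff)
  have "L = T L"
  proof (rule eq_matI)
    fix i j assume "i < dim_row (T L)" "j < dim_col (T L)"
    then have ij: "i < m" "j < p" using T[OF L] by auto
    have T_entry: "T X $$ (i, j) = \<bar>(P * X * Q) $$ (i, j)\<bar> + F $$ (i, j)" for X
      using P Q F ij by (simp add: T_def del: index_mult_mat(1))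
    \<comment> \<open>The shifted orbit tends to \<open>T L\<close> by continuity of
      \<open>T\<close>, and to \<open>L\<close> as a shift of a convergent sequence.\<close>
    have "(\<lambda>k. Y (Suc k) $$ (i, j)) \<longlonglongrightarrow> T L $$ (i, j)"
      unfolding Y_Suc T_entry by (intro tendsto_intros tendsto_sandwich_entry[OF P Q Y L lim ij])
    then show "L $$ (i, j) = T L $$ (i, j)"
      by (rule LIMSEQ_unique[OF LIMSEQ_Suc[OF lim[OF ij]]])
  qed (use L T[OF L] in auto)
  moreover have "X = L" if X: "X \<in> carrier_mat m p" "X = T X" for X
  proof (rule eq_matI)
    fix i j assume "i < dim_row L" "j < dim_col L"
    then have ij: "i < m" "j < p" using L by auto
    \<comment> \<open>Fixed points are constant orbits, so their distance does not depend on
      \<open>k\<close> while its bound tends to 0.\<close>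
    obtain K where K: "\<forall>k i j. i < m \<longrightarrow> j < p \<longrightarrow> \<bar>X $$ (i, j) - L $$ (i, j)\<bar> \<le> K * r ^ k"
      using iterates[of "\<lambda>_. X" "\<lambda>_. L", OF X L \<open>L = T L\<close>] ..
    have "\<bar>X $$ (i, j) - L $$ (i, j)\<bar> \<le> 0"
      by (rule LIMSEQ_le_const[OF geometric_null[of K]]) (use K ij in simp)
    then show "X $$ (i, j) = L $$ (i, j)" by simp
  qed (use X(1) L in auto)
  ultimately have "\<exists>!X. X \<in> carrier_mat m p \<and> X = T X"
    using L by metis
  then show ?thesis by (simp only: T_def)
qed

section \<open>Reduction of the equation to the fixed point problem\<close>

lemma minus_eq_iff_eq_add_mat:
  fixes X Y Z :: "'a :: group_add mat"
  assumes "X \<in> carrier_mat nr nc" "Y \<in> carrier_mat nr nc" "Z \<in> carrier_mat nr nc"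
  shows "X - Y = Z \<longleftrightarrow> X = Z + Y"
  using assms by (auto simp: mat_eq_iff diff_eq_eq)

theorem theorem2p2:
  fixes m p :: nat and A B C D :: "real mat"
  assumes "m > 0" and "p > 0"
    and "A \<in> carrier_mat m m" and "C \<in> carrier_mat m m"
    and "B \<in> carrier_mat p p" and "D \<in> carrier_mat p p"
    and "invertible_mat A" and "invertible_mat B"
    and "real_spectral_radius (abs_mat (mat_inv B * D)) *
         real_spectral_radius (abs_mat (C * mat_inv A)) < 1"
  shows "\<forall>F \<in> carrier_mat m p.
    \<exists>!X. X \<in> carrier_mat m p \<and> A * X * B - abs_mat (C * X * D) = F"
proof
  fix F :: "real mat" assume F: "F \<in> carrier_mat m p"
  note A = \<open>A \<in> carrier_mat m m\<close> and C = \<open>C \<in> carrier_mat m m\<close>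
    and B = \<open>B \<in> carrier_mat p p\<close> and D = \<open>D \<in> carrier_mat p p\<close>
  note iA = mat_inv[OF A \<open>invertible_mat A\<close>] and iB = mat_inv[OF B \<open>invertible_mat B\<close>]
  let ?P = "C * mat_inv A" and ?Q = "mat_inv B * D"
  have P: "?P \<in> carrier_mat m m" and Q: "?Q \<in> carrier_mat p p" using C D iA(1) iB(1) by auto
  \<comment> \<open>The change of unknown and its inverse; uniqueness of \<open>Y\<close> carries
    over to \<open>X\<close> because they are mutually inverse on \<open>m\<close> by
    \<open>p\<close> matrices.\<close>
  define to_Y where "to_Y = (\<lambda>X. A * X * B)"
  define to_X where "to_X = (\<lambda>Y. mat_inv A * Y * mat_inv B)"
  have carr: "to_Y X \<in> carrier_mat m p" "to_X X \<in> carrier_mat m p"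
    if "X \<in> carrier_mat m p" for X
    using that A B iA(1) iB(1) by (auto simp: to_Y_def to_X_def)
  have "?P * A = C" "B * ?Q = D"
    using assoc_mult_mat[OF C iA(1) A] assoc_mult_mat[OF B iB(1) D] iA(3) iB(2) C D by simp_all
  \<comment> \<open>All three are the same regrouping: the outer factors meet \<open>A\<close> on
    the left and \<open>B\<close> on the right of \<open>X\<close>, or the inverses of
    these.\<close>
  then have XY: "to_X (to_Y X) = X" and YX: "to_Y (to_X X) = X" and
    CD: "?P * to_Y X * ?Q = C * X * D"
    if X: "X \<in> carrier_mat m p" for X
    using sandwich_sandwich_mat[OF iA(1) A X B iB(1)] sandwich_sandwich_mat[OF A iA(1) X iB(1) B]
      sandwich_sandwich_mat[OF P A X B Q] iA(2,3) iB(2,3) X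
    by (simp_all only: to_X_def to_Y_def left_mult_one_mat right_mult_one_mat)
  have eqn: "to_Y X - abs_mat (C * X * D) = F \<longleftrightarrow> to_Y X = abs_mat (?P * to_Y X * ?Q) + F"
    if X: "X \<in> carrier_mat m p" for X
  proof -
    have "abs_mat (C * X * D) \<in> carrier_mat m p" using C D X by simp
    from minus_eq_iff_eq_add_mat[OF carr(1)[OF X] this F] comm_add_mat[OF F this]
    show ?thesis by (simp only: CD[OF X])
  qed
  \<comment> \<open>The hypothesis lists the two spectral radii in the opposite order, hence the
    commutation.\<close>
  have "\<exists>!Y. Y \<in> carrier_mat m p \<and> Y = abs_mat (?P * Y * ?Q) + F"
    using assms(9) by (intro abs_sandwich_fixed_point_unique[OF P Q F assms(1,2)])
      (simp add: mult.commute)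
  then obtain Y where Y: "Y \<in> carrier_mat m p" "Y = abs_mat (?P * Y * ?Q) + F"
    and uniq: "\<And>Z. Z \<in> carrier_mat m p \<Longrightarrow> Z = abs_mat (?P * Z * ?Q) + F \<Longrightarrow> Z = Y"
    by blast
  show "\<exists>!X. X \<in> carrier_mat m p \<and> A * X * B - abs_mat (C * X * D) = F"
  proof (rule ex1I[of _ "to_X Y"])
    show "to_X Y \<in> carrier_mat m p \<and> A * to_X Y * B - abs_mat (C * to_X Y * D) = F"
      using eqn[OF carr(2)[OF Y(1)], unfolded YX[OF Y(1)]] Y(2) carr(2)[OF Y(1)] YX[OF Y(1)]
      unfolding to_Y_def by metis
  next
    fix X assume X: "X \<in> carrier_mat m p \<and> A * X * B - abs_mat (C * X * D) = F"
    then have "to_Y X - abs_mat (C * X * D) = F" by (simp only: to_Y_def)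
    with X have "to_Y X = Y" using eqn uniq carr(1) by blast
    then show "X = to_X Y" using XY[of X] X by simp
  qed
qed

end
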